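(* (a) The state $\widetilde{\Psi}_{BCS}$ is the ground state of $\widetilde{H}_M$, and the ground state energy $\widetilde{E}_{BCS}$ is given by $$\widetilde{E}_{BCS}=\sum_{k\in\Lambda}\left\{\xi_k-\sqrt{\xi_k^2+\widetilde{\Delta}_k^2}+\widetilde{\Delta}_k\left(\widetilde{\Psi},C_{-k\downarrow}C_{k\uparrow}\widetilde{\Psi}\right)\right\}.$$ (b) With this $\widetilde{E}_{BCS}$, the spectrum of $\widetilde{H}_M$ is $$\sigma(\widetilde{H}_M)=\left\{\sum_{k\in\Lambda}\sqrt{\xi_k^2+\widetilde{\Delta}_k^2}\,(N_{k\uparrow}+N_{k\downarrow})+\widetilde{E}_{BCS}\ :\ N_{k\uparrow},N_{k\downarrow}\in\{0,1\}\ (k\in\Lambda)\right\}.$$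
   Context: Fix (large) real numbers $L,K_{max}>0$ and let $\Lambda=\{\frac{2\pi}{L}(n_1,n_2,n_3)\in\mathbb{R}^3: n_1,n_2,n_3\in\mathbb{Z},\ \frac{2\pi}{L}\sqrt{n_1^2+n_2^2+n_3^2}\le K_{max}\}$, a finite set with $M$ elements, whose elements are arranged in a fixed order. Let $\mathcal{H}=\mathbb{C}^{2^{2M}}$ with its standard inner product $(\cdot,\cdot)$; its standard unit vectors are labelled $|n_{k\uparrow},n_{k\downarrow},n_{k'\uparrow},n_{k'\downarrow},\ldots\rangle$ with $n_{k\sigma}\in\{0,1\}$, $k\in\Lambda$, $\sigma\in\{\uparrow,\downarrow\}$, and $|0\rangle$ denotes the one with all $n_{k\sigma}=0$. The annihilation operator $C_{k\sigma}$ is the linear operator on $\mathcal{H}$ which sends a standard unit vector with $n_{k\sigma}=1$ to $(-1)^{s}$ times the standard unit vector obtained by replacing $n_{k\sigma}$ by $0$, where $s$ is the sum of the occupation numbers to the left of $n_{k\sigma}$, and sends a standard unit vector with $n_{k\sigma}=0$ to $0$. The creation operator $C_{k\sigma}^*$ sends a standard unit vector with $n_{k\sigma}=0$ to $(-1)^{s}$ times the one with $n_{k\sigma}$ replaced by $1$ (same $s$), and one with $n_{k\sigma}=1$ to $0$; it is the adjoint of $C_{k\sigma}$. Let $m,\mu,\hbar>0$ and $\xi_k=\hbar^2|k|^2/(2m)-\mu$. Let $U_{k,k'}$ ($k,k'\in\Lambda$) be real with $U_{k,k'}\le 0$, $U_{k',k}=U_{k,k'}$, $U_{-k,-k'}=U_{k,k'}$,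 $U_{k,k}=0$. It is assumed that there is a function $\widetilde\Delta_k\ge0$ of $k\in\Lambda$ with $\widetilde\Delta_{-k}=\widetilde\Delta_k$ and $\widetilde E_k:=\sqrt{\xi_k^2+\widetilde\Delta_k^2}>0$ for all $k$, solving the new gap equation $$\widetilde\Delta_k=-\frac12\sum_{k'\in\Lambda}U_{k,k'}\frac{\widetilde\Delta_{k'}}{\widetilde E_{k'}}\left(1-\frac{4D_{k'}}{D+2}\right),\quad D_{k'}=\frac14\sum_{p\in\Lambda}\frac{U_{k',p}^2}{(\widetilde E_{k'}+\widetilde E_p)^2}\left(1-\frac{\xi_{k'}\xi_p}{\widetilde E_{k'}\widetilde E_p}\right)^2,\quad D=\sum_{k'\in\Lambda}D_{k'};$$ fix such a $\widetilde\Delta$. Let $\widetilde\theta_k\in[0,\pi/2]$ satisfy $\sin2\widetilde\theta_k=\widetilde\Delta_k/\widetilde E_k$, $\cos2\widetilde\theta_k=\xi_k/\widetilde E_k$. Let $\widetilde G_B=i\sum_{k\in\Lambda}\widetilde\theta_k(C_{-k\downarrow}C_{k\uparrow}-C_{k\uparrow}^*C_{-k\downarrow}^* )$, $\widetilde\Psi_{BCS}=e^{i\widetilde G_B}|0\rangle$, $\widetilde\gamma_{k\sigma}=e^{i\widetilde G_B}C_{k\sigma}e^{-i\widetilde G_B}$ (adjoint $\widetilde\gamma_{k\sigma}^*$), and write $\widetilde S_k=\sin\widetilde\theta_k$, $\widetilde C_k=\cos\widetilde\theta_k$. Put $$\widetilde\Phi=\frac12\sum_{p,p'\in\Lambda}\frac{U_{p,p'}(\widetilde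 C_p^2\widetilde S_{p'}^2+\widetilde C_{p'}^2\widetilde S_p^2)}{\widetilde E_p+\widetilde E_{p'}}\widetilde\gamma_{p\uparrow}^*\widetilde\gamma_{-p\downarrow}^*\widetilde\gamma_{p'\uparrow}^*\widetilde\gamma_{-p'\downarrow}^*\widetilde\Psi_{BCS},\qquad\widetilde\Psi=\frac{\widetilde\Psi_{BCS}+\widetilde\Phi}{\sqrt{1+(\widetilde\Phi,\widetilde\Phi)}}.$$ The mean field Hamiltonian is $$\widetilde H_M=\sum_{k\in\Lambda,\,\sigma=\uparrow,\downarrow}\xi_kC_{k\sigma}^*C_{k\sigma}-\sum_{k\in\Lambda}\widetilde\Delta_k\left(C_{-k\downarrow}C_{k\uparrow}+C_{k\uparrow}^*C_{-k\downarrow}^*\right)+\sum_{k\in\Lambda}\widetilde\Delta_k\left(\widetilde\Psi,C_{-k\downarrow}C_{k\uparrow}\widetilde\Psi\right).$$ A ground state of a selfadjoint operator on $\mathcal{H}$ is a unit eigenvector belonging to its smallest eigenvalue, and this eigenvalue is the ground state energy. *)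

theory Defs
  imports "HOL-Analysis.Analysis"
begin

datatype spin = Up | Down

instance spin :: finite
proof
  have "(UNIV :: spin set) \<subseteq> {Up, Down}"
    by (auto intro: spin.exhaust)
  then show "finite (UNIV :: spin set)"
    by (rule finite_subset) simp
qed

text \<open>
  The dimension of the Hilbert space depends on the number M of momenta, so the momenta are
  enumerated by a finite linearly ordered index type 'q with M elements: a bijection
  lab from the momentum set onto 'q is the fixed arrangement of the momenta. A standard unit
  vector is axis n 1, where n (lab k, s) tells whether the occupation number of (k, s) is 1;
  there are 2 ^ (2 * M) such n.
\<close>

type_synonym 'q occ = "'q \<times> spin \<Rightarrow> bool"
type_synonym 'q fock = "complex ^ ('q \<times> spin \<Rightarrow> bool)"

definition momenta :: "real \<Rightarrow> real \<Rightarrow> (real ^ 3) set" where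
  "momenta L Kmax =
     {(2 * pi / L) *\<^sub>R vector [real_of_int n1, real_of_int n2, real_of_int n3] | n1 n2 n3 :: int.
        2 * pi / L * sqrt (real_of_int (n1\<^sup>2 + n2\<^sup>2 + n3\<^sup>2)) \<le> Kmax}"

subsection \<open>Operators on a finite-dimensional complex inner product space\<close>

text \<open>The library inner product on complex vectors is the real part of this one; its norm is
  the norm of both.\<close>

definition cinner :: "complex ^ 'n \<Rightarrow> complex ^ 'n \<Rightarrow> complex" where
  "cinner x y = (\<Sum>i\<in>UNIV. cnj (x $ i) * y $ i)"

definition op_exp :: "(complex ^ 'n \<Rightarrow> complex ^ 'n) \<Rightarrow> complex ^ 'n \<Rightarrow> complex ^ 'n" where
  "op_exp A v = (\<Sum>j. (1 / fact j) *\<^sub>R (A ^^ j) v)"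

definition op_adjoint :: "(complex ^ 'n \<Rightarrow> complex ^ 'n) \<Rightarrow> complex ^ 'n \<Rightarrow> complex ^ 'n" where
  "op_adjoint A = (THE B. \<forall>x y. cinner (A x) y = cinner x (B y))"

definition selfadjoint :: "(complex ^ 'n \<Rightarrow> complex ^ 'n) \<Rightarrow> bool" where
  "selfadjoint A \<longleftrightarrow> (\<forall>x y. cinner (A x) y = cinner x (A y))"

definition op_eigenvalue :: "(complex ^ 'n \<Rightarrow> complex ^ 'n) \<Rightarrow> complex \<Rightarrow> bool" where
  "op_eigenvalue A z \<longleftrightarrow> (\<exists>v. v \<noteq> 0 \<and> A v = z *s v)"

definition op_spectrum :: "(complex ^ 'n \<Rightarrow> complex ^ 'n) \<Rightarrow> complex set" where
  "op_spectrum A = {z. \<not> bij (\<lambda>v. A v - z *s v)}"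

definition ground_state_energy :: "(complex ^ 'n \<Rightarrow> complex ^ 'n) \<Rightarrow> real" where
  "ground_state_energy A = (LEAST E. op_eigenvalue A (complex_of_real E))"

text \<open>The third conjunct makes the eigenvalue the minimum, so that the LEAST above exists;
  eigenvalues of a selfadjoint operator are real.\<close>

definition is_ground_state :: "(complex ^ 'n \<Rightarrow> complex ^ 'n) \<Rightarrow> complex ^ 'n \<Rightarrow> bool" where
  "is_ground_state A \<psi> \<longleftrightarrow> selfadjoint A \<and> norm \<psi> = 1 \<and>
     (\<exists>E. A \<psi> = complex_of_real E *s \<psi> \<and>
          (\<forall>E'. op_eigenvalue A (complex_of_real E') \<longrightarrow> E \<le> E'))"

subsection \<open>Creation and annihilation operators\<close>

definition left_of :: "'q::linorder \<times> spin \<Rightarrow> 'q \<times> spin \<Rightarrow> bool" where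
  "left_of b a \<longleftrightarrow> fst b < fst a \<or> fst b = fst a \<and> snd b = Up \<and> snd a = Down"

definition occ_sign :: "'q::{finite,linorder} \<times> spin \<Rightarrow> 'q occ \<Rightarrow> complex" where
  "occ_sign a n = (-1) ^ card {b. left_of b a \<and> n b}"

text \<open>Linear extensions of the prescribed action on the standard unit vectors.\<close>

definition annih :: "(real ^ 3 \<Rightarrow> 'q::{finite,linorder}) \<Rightarrow> real ^ 3 \<Rightarrow> spin \<Rightarrow> 'q fock \<Rightarrow> 'q fock" where
  "annih lab k \<sigma> v = (\<Sum>n\<in>UNIV. v $ n *s
     (if n (lab k, \<sigma>) then occ_sign (lab k, \<sigma>) n *s axis (n((lab k, \<sigma>) := False)) 1 else 0))"

definition creat :: "(real ^ 3 \<Rightarrow> 'q::{finite,linorder}) \<Rightarrow> real ^ 3 \<Rightarrow> spin \<Rightarrow> 'q fock \<Rightarrow> 'q fock" where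
  "creat lab k \<sigma> v = (\<Sum>n\<in>UNIV. v $ n *s
     (if n (lab k, \<sigma>) then 0 else occ_sign (lab k, \<sigma>) n *s axis (n((lab k, \<sigma>) := True)) 1))"

definition vacuum :: "'q::finite fock" where
  "vacuum = axis (\<lambda>_. False) 1"

subsection \<open>The gap equation\<close>

definition dispersion :: "real \<Rightarrow> real \<Rightarrow> real \<Rightarrow> real ^ 3 \<Rightarrow> real" where
  "dispersion hbar m \<mu> k = hbar\<^sup>2 * (norm k)\<^sup>2 / (2 * m) - \<mu>"

definition qp_energy :: "(real ^ 3 \<Rightarrow> real) \<Rightarrow> (real ^ 3 \<Rightarrow> real) \<Rightarrow> real ^ 3 \<Rightarrow> real" where
  "qp_energy \<xi> \<Delta> k = sqrt ((\<xi> k)\<^sup>2 + (\<Delta> k)\<^sup>2)"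

definition D_mom :: "(real ^ 3) set \<Rightarrow> (real ^ 3 \<Rightarrow> real) \<Rightarrow> (real ^ 3 \<Rightarrow> real ^ 3 \<Rightarrow> real)
    \<Rightarrow> (real ^ 3 \<Rightarrow> real) \<Rightarrow> real ^ 3 \<Rightarrow> real" where
  "D_mom \<Lambda> \<xi> U \<Delta> k = 1 / 4 * (\<Sum>p\<in>\<Lambda>. (U k p)\<^sup>2 / (qp_energy \<xi> \<Delta> k + qp_energy \<xi> \<Delta> p)\<^sup>2 *
     (1 - \<xi> k * \<xi> p / (qp_energy \<xi> \<Delta> k * qp_energy \<xi> \<Delta> p))\<^sup>2)"

definition D_total :: "(real ^ 3) set \<Rightarrow> (real ^ 3 \<Rightarrow> real) \<Rightarrow> (real ^ 3 \<Rightarrow> real ^ 3 \<Rightarrow> real)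
    \<Rightarrow> (real ^ 3 \<Rightarrow> real) \<Rightarrow> real" where
  "D_total \<Lambda> \<xi> U \<Delta> = (\<Sum>k\<in>\<Lambda>. D_mom \<Lambda> \<xi> U \<Delta> k)"

definition solves_gap_equation :: "(real ^ 3) set \<Rightarrow> (real ^ 3 \<Rightarrow> real)
    \<Rightarrow> (real ^ 3 \<Rightarrow> real ^ 3 \<Rightarrow> real) \<Rightarrow> (real ^ 3 \<Rightarrow> real) \<Rightarrow> bool" where
  "solves_gap_equation \<Lambda> \<xi> U \<Delta> \<longleftrightarrow>
     (\<forall>k\<in>\<Lambda>. \<Delta> k = - (1 / 2) * (\<Sum>k'\<in>\<Lambda>. U k k' * (\<Delta> k' / qp_energy \<xi> \<Delta> k') *
        (1 - 4 * D_mom \<Lambda> \<xi> U \<Delta> k' / (D_total \<Lambda> \<xi> U \<Delta> + 2))))"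

subsection \<open>States and the mean field Hamiltonian\<close>

definition G_B :: "(real ^ 3) set \<Rightarrow> (real ^ 3 \<Rightarrow> 'q::{finite,linorder}) \<Rightarrow> (real ^ 3 \<Rightarrow> real)
    \<Rightarrow> 'q fock \<Rightarrow> 'q fock" where
  "G_B \<Lambda> lab \<theta> v = \<i> *s (\<Sum>k\<in>\<Lambda>. \<theta> k *\<^sub>R
     (annih lab (-k) Down (annih lab k Up v) - creat lab k Up (creat lab (-k) Down v)))"

definition Psi_BCS :: "(real ^ 3) set \<Rightarrow> (real ^ 3 \<Rightarrow> 'q::{finite,linorder}) \<Rightarrow> (real ^ 3 \<Rightarrow> real)
    \<Rightarrow> 'q fock" where
  "Psi_BCS \<Lambda> lab \<theta> = op_exp (\<lambda>v. \<i> *s G_B \<Lambda> lab \<theta> v) vacuum"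

definition qp_annih :: "(real ^ 3) set \<Rightarrow> (real ^ 3 \<Rightarrow> 'q::{finite,linorder}) \<Rightarrow> (real ^ 3 \<Rightarrow> real)
    \<Rightarrow> real ^ 3 \<Rightarrow> spin \<Rightarrow> 'q fock \<Rightarrow> 'q fock" where
  "qp_annih \<Lambda> lab \<theta> k \<sigma> v =
     op_exp (\<lambda>w. \<i> *s G_B \<Lambda> lab \<theta> w) (annih lab k \<sigma> (op_exp (\<lambda>w. (- \<i>) *s G_B \<Lambda> lab \<theta> w) v))"

definition qp_creat :: "(real ^ 3) set \<Rightarrow> (real ^ 3 \<Rightarrow> 'q::{finite,linorder}) \<Rightarrow> (real ^ 3 \<Rightarrow> real)
    \<Rightarrow> real ^ 3 \<Rightarrow> spin \<Rightarrow> 'q fock \<Rightarrow> 'q fock" where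
  "qp_creat \<Lambda> lab \<theta> k \<sigma> = op_adjoint (qp_annih \<Lambda> lab \<theta> k \<sigma>)"

definition Phi :: "(real ^ 3) set \<Rightarrow> (real ^ 3 \<Rightarrow> 'q::{finite,linorder}) \<Rightarrow> (real ^ 3 \<Rightarrow> real)
    \<Rightarrow> (real ^ 3 \<Rightarrow> real ^ 3 \<Rightarrow> real) \<Rightarrow> (real ^ 3 \<Rightarrow> real) \<Rightarrow> (real ^ 3 \<Rightarrow> real) \<Rightarrow> 'q fock" where
  "Phi \<Lambda> lab \<xi> U \<Delta> \<theta> = (1 / 2) *\<^sub>R (\<Sum>p\<in>\<Lambda>. \<Sum>p'\<in>\<Lambda>.
     (U p p' * ((cos (\<theta> p))\<^sup>2 * (sin (\<theta> p'))\<^sup>2 + (cos (\<theta> p'))\<^sup>2 * (sin (\<theta> p))\<^sup>2)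
        / (qp_energy \<xi> \<Delta> p + qp_energy \<xi> \<Delta> p')) *\<^sub>R
     qp_creat \<Lambda> lab \<theta> p Up (qp_creat \<Lambda> lab \<theta> (-p) Down
       (qp_creat \<Lambda> lab \<theta> p' Up (qp_creat \<Lambda> lab \<theta> (-p') Down (Psi_BCS \<Lambda> lab \<theta>)))))"

definition Psi :: "(real ^ 3) set \<Rightarrow> (real ^ 3 \<Rightarrow> 'q::{finite,linorder}) \<Rightarrow> (real ^ 3 \<Rightarrow> real)
    \<Rightarrow> (real ^ 3 \<Rightarrow> real ^ 3 \<Rightarrow> real) \<Rightarrow> (real ^ 3 \<Rightarrow> real) \<Rightarrow> (real ^ 3 \<Rightarrow> real) \<Rightarrow> 'q fock" where
  "Psi \<Lambda> lab \<xi> U \<Delta> \<theta> =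
     (1 / sqrt (1 + Re (cinner (Phi \<Lambda> lab \<xi> U \<Delta> \<theta>) (Phi \<Lambda> lab \<xi> U \<Delta> \<theta>)))) *\<^sub>R
     (Psi_BCS \<Lambda> lab \<theta> + Phi \<Lambda> lab \<xi> U \<Delta> \<theta>)"

definition pair_expectation :: "(real ^ 3 \<Rightarrow> 'q::{finite,linorder}) \<Rightarrow> 'q fock \<Rightarrow> real ^ 3 \<Rightarrow> complex" where
  "pair_expectation lab \<psi> k = cinner \<psi> (annih lab (-k) Down (annih lab k Up \<psi>))"

definition H_M :: "(real ^ 3) set \<Rightarrow> (real ^ 3 \<Rightarrow> 'q::{finite,linorder}) \<Rightarrow> (real ^ 3 \<Rightarrow> real)
    \<Rightarrow> (real ^ 3 \<Rightarrow> real ^ 3 \<Rightarrow> real) \<Rightarrow> (real ^ 3 \<Rightarrow> real) \<Rightarrow> (real ^ 3 \<Rightarrow> real)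
    \<Rightarrow> 'q fock \<Rightarrow> 'q fock" where
  "H_M \<Lambda> lab \<xi> U \<Delta> \<theta> v =
     (\<Sum>k\<in>\<Lambda>. \<Sum>\<sigma>\<in>{Up, Down}. \<xi> k *\<^sub>R creat lab k \<sigma> (annih lab k \<sigma> v))
     - (\<Sum>k\<in>\<Lambda>. \<Delta> k *\<^sub>R (annih lab (-k) Down (annih lab k Up v)
                         + creat lab k Up (creat lab (-k) Down v)))
     + (\<Sum>k\<in>\<Lambda>. complex_of_real (\<Delta> k) * pair_expectation lab (Psi \<Lambda> lab \<xi> U \<Delta> \<theta>) k) *s v"

end

theory Submission imports Defs begin

text \<open>
  With \<open>a = k Up\<close> and \<open>b = -k Down\<close>, the anticommutation relations make the operators
  \<open>C\<^sub>a\<^sup>* C\<^sub>b\<^sup>* - C\<^sub>b C\<^sub>a\<close>, \<open>C\<^sub>a\<^sup>* C\<^sub>b\<^sup>* + C\<^sub>b C\<^sub>a\<close> and \<open>n\<^sub>a + n\<^sub>b - 1\<close> a copy of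
  \<open>su(2)\<close>, and the copies for different \<open>k\<close> commute. Up to an additive constant the mean field Hamiltonian is
  the sum over \<open>k\<close> of \<open>E\<^sub>k\<close> times \<open>cos (2 \<theta>\<^sub>k)\<close> times the third minus \<open>sin (2 \<theta>\<^sub>k)\<close> times the second
  operator. Conjugation by the isometry \<open>exp (i G\<^sub>B)\<close> rotates the third operator into exactly this combination, so
  the image of the occupation number basis diagonalizes the Hamiltonian.
\<close>

subsection \<open>Linear operators on complex coordinate space\<close>

abbreviation clinear :: "(complex ^ 'n \<Rightarrow> complex ^ 'n) \<Rightarrow> bool" where
  "clinear \<equiv> Vector_Spaces.linear (*s) (*s)"

lemma scaleR_eq_smult: "r *\<^sub>R v = complex_of_real r *s (v :: complex ^ 'n)"
  unfolding vec_eq_iff vector_scaleR_component vector_smult_component by (simp add: scaleR_conv_of_real)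

lemma clinearI:
  assumes "\<And>x y. f (x + y) = f x + f y" and "\<And>c x. f (c *s x) = c *s f x"
  shows "clinear f"
  using assms by unfold_locales auto

lemma clinear_imp_linear: "clinear f \<Longrightarrow> linear f"
  by (intro linearI) (simp_all add: scaleR_eq_smult vec.linear_add vec.linear_scale)

lemma cinner_axis_left: "cinner (axis i 1) y = y $ i"
proof -
  have "cinner (axis i 1) y = (\<Sum>j\<in>UNIV. if j = i then y $ j else 0)"
    unfolding cinner_def by (intro sum.cong) (auto simp: axis_def)
  then show ?thesis
    by simp
qed

lemma Re_cinner: "Re (cinner x y) = x \<bullet> y"
  by (simp add: cinner_def inner_vec_def inner_complex_def)

lemma cinner_add_left: "cinner (x + y) z = cinner x z + cinner y z"
  and cinner_add_right: "cinner z (x + y) = cinner z x + cinner z y"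
  and cinner_diff_left: "cinner (x - y) z = cinner x z - cinner y z"
  and cinner_diff_right: "cinner z (x - y) = cinner z x - cinner z y"
  by (simp_all add: cinner_def algebra_simps sum.distrib sum_subtractf)

lemma cinner_smult_left: "cinner (c *s x) z = cnj c * cinner x z"
  and cinner_smult_right: "cinner z (c *s x) = c * cinner z x"
  by (simp_all add: cinner_def algebra_simps sum_distrib_left)

lemma cinner_zero_left: "cinner 0 z = 0"
  and cinner_zero_right: "cinner z 0 = 0"
  by (simp_all add: cinner_def)

lemma cinner_sum_left: "cinner (sum f A) z = (\<Sum>i\<in>A. cinner (f i) z)"
  by (induction A rule: infinite_finite_induct) (auto simp: cinner_add_left cinner_zero_left)

lemma cinner_sum_right: "cinner z (sum f A) = (\<Sum>i\<in>A. cinner z (f i))"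
  by (induction A rule: infinite_finite_induct) (auto simp: cinner_add_right cinner_zero_right)

lemmas cinner_simps = cinner_add_left cinner_add_right cinner_diff_left cinner_diff_right
  cinner_smult_left cinner_smult_right cinner_zero_left cinner_zero_right
  cinner_sum_left cinner_sum_right

lemma clinear_expand:
  assumes "clinear T"
  shows "T v = (\<Sum>i\<in>UNIV. v $ i *s T (axis i 1))"
proof -
  have "T v = T (\<Sum>i\<in>UNIV. v $ i *s axis i 1)"
    by (simp add: basis_expansion)
  then show ?thesis
    using assms by (simp add: vec.linear_sum vec.linear_scale)
qed

text \<open>\<open>op_adjoint\<close> is a definite description, so existence and uniqueness are
  both needed. Expanding the first argument in the standard basis gives existence; testing with
  basis vectors gives uniqueness. The formula later transfers reality of coordinates from an
  operator to its adjoint.\<close>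

lemma op_adjoint_component:
  assumes "clinear T"
  shows "op_adjoint T y $ i = cinner (T (axis i 1)) y"
proof -
  let ?B = "\<lambda>y. \<chi> i. cinner (T (axis i 1)) y"
  have "op_adjoint T = ?B"
    unfolding op_adjoint_def
  proof (rule the_equality)
    show "\<forall>x y. cinner (T x) y = cinner x (?B y)"
      by (subst clinear_expand[OF assms])
         (simp add: cinner_sum_left cinner_smult_left, simp add: cinner_def)
  next
    fix B assume B: "\<forall>x y. cinner (T x) y = cinner x (B y)"
    show "B = ?B"
      by (rule ext) (simp add: vec_eq_iff B cinner_axis_left)
  qed
  then show ?thesis
    by simp
qed

subsection \<open>The exponential of an operator\<close>

text \<open>In finite dimension \<open>A\<close> has an operator bound \<open>K\<close>, so the
  series is dominated by the exponential series of \<open>\<bar>t\<bar> * K\<close>. The parameter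
  \<open>t\<close> is kept because the exponential is later differentiated as a power series in
  it.\<close>

lemma summable_op_exp:
  fixes A :: "complex ^ 'n \<Rightarrow> complex ^ 'n"
  assumes "linear A"
  shows "summable (\<lambda>j. (t ^ j / fact j) *\<^sub>R (A ^^ j) v)"
proof -
  from assms have "bounded_linear A"
    by (simp add: linear_linear)
  then obtain K where K: "K > 0" "\<And>x. norm (A x) \<le> norm x * K"
    using bounded_linear.pos_bounded by blast
  have pow: "norm ((A ^^ j) v) \<le> norm v * K ^ j" for j
  proof (induction j)
    case (Suc j)
    have "norm ((A ^^ Suc j) v) \<le> norm ((A ^^ j) v) * K"
      using K(2) by simp
    also have "\<dots> \<le> norm v * K ^ j * K"
      using Suc K(1) by (intro mult_right_mono) auto
    finally show ?case
      by (simp add: algebra_simps)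
  qed simp
  have "summable (\<lambda>j. norm v * ((\<bar>t\<bar> * K) ^ j /\<^sub>R fact j))"
    by (intro summable_mult summable_exp_generic)
  then show ?thesis
  proof (rule summable_comparison_test'[where N = 0])
    fix j :: nat
    have "norm ((t ^ j / fact j) *\<^sub>R (A ^^ j) v) = \<bar>t\<bar> ^ j / fact j * norm ((A ^^ j) v)"
      by (simp add: power_abs)
    also have "\<dots> \<le> \<bar>t\<bar> ^ j / fact j * (norm v * K ^ j)"
      by (intro mult_left_mono pow) auto
    finally show "norm ((t ^ j / fact j) *\<^sub>R (A ^^ j) v) \<le> norm v * ((\<bar>t\<bar> * K) ^ j /\<^sub>R fact j)"
      by (simp add: power_mult_distrib divide_simps mult_ac)
  qed
qed

lemma summable_op_exp': "linear A \<Longrightarrow> summable (\<lambda>j. (1 / fact j) *\<^sub>R (A ^^ j) v)"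
  for A :: "complex ^ 'n \<Rightarrow> complex ^ 'n"
  using summable_op_exp[of A 1 v] by simp

lemma op_exp_scaled:
  fixes A :: "complex ^ 'n \<Rightarrow> complex ^ 'n"
  assumes "linear A"
  shows "op_exp (\<lambda>w. t *\<^sub>R A w) v = (\<Sum>j. (t ^ j / fact j) *\<^sub>R (A ^^ j) v)"
proof -
  have "((\<lambda>w. t *\<^sub>R A w) ^^ j) v = t ^ j *\<^sub>R (A ^^ j) v" for j
    by (induction j) (simp_all add: linear_scale[OF assms])
  then show ?thesis
    unfolding op_exp_def by simp
qed

text \<open>\<open>B\<close> passes through every power of \<open>A\<close>, and its continuity lets
  it pass through the infinite sum. Taking \<open>B\<close> to be multiplication by a complex scalar
  gives homogeneity of the exponential; taking \<open>B = A\<close> lets a generator commute with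
  its flow.\<close>

lemma op_exp_intertwine:
  fixes A A' B :: "complex ^ 'n \<Rightarrow> complex ^ 'n"
  assumes "linear A" "linear B" and AB: "\<And>x. B (A x) = A' (B x)"
  shows "B (op_exp A v) = op_exp A' (B v)"
proof -
  have "B ((A ^^ j) v) = (A' ^^ j) (B v)" for j
    by (induction j) (simp_all add: AB)
  moreover have "bounded_linear B"
    using assms(2) by (simp add: linear_linear)
  ultimately show ?thesis
    unfolding op_exp_def
    by (simp add: bounded_linear.suminf[OF _ summable_op_exp'[OF assms(1)]] linear_scale[OF assms(2)])
qed

lemma clinear_op_exp:
  assumes "clinear A"
  shows "clinear (op_exp A)"
proof (rule clinearI)
  have lin: "linear A"
    using assms by (rule clinear_imp_linear)
  have lin_pow: "(A ^^ j) (x + y) = (A ^^ j) x + (A ^^ j) y" for j x y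
    by (induction j) (simp_all add: linear_add[OF lin])
  show "op_exp A (x + y) = op_exp A x + op_exp A y" for x y
    unfolding op_exp_def
    by (simp add: suminf_add summable_op_exp'[OF lin] lin_pow scaleR_add_right)
  show "op_exp A (c *s x) = c *s op_exp A x" for c x
  proof (rule op_exp_intertwine[symmetric, OF lin])
    show "linear (\<lambda>x. c *s x :: complex ^ 'a)"
      by (intro clinear_imp_linear clinearI) (simp_all add: vec.scale_right_distrib mult.commute)
    show "c *s A x = A (c *s x)" for x
      using assms by (simp add: vec.linear_scale)
  qed
qed

text \<open>The inner product of the flow with any fixed vector is an everywhere convergent real
  power series in \<open>t\<close>, which may be differentiated termwise.\<close>

lemma op_exp_has_vector_derivative:
  fixes A :: "complex ^ 'n \<Rightarrow> complex ^ 'n"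
  assumes lin: "linear A"
  shows "((\<lambda>t. op_exp (\<lambda>w. t *\<^sub>R A w) v) has_vector_derivative
           A (op_exp (\<lambda>w. t *\<^sub>R A w) v)) (at t)"
proof -
  have comp: "op_exp (\<lambda>w. s *\<^sub>R A w) x \<bullet> b = (\<Sum>j. ((A ^^ j) x \<bullet> b / fact j) * s ^ j)"
    and summ: "summable (\<lambda>j. ((A ^^ j) x \<bullet> b / fact j) * s ^ j)" for s x b
  proof -
    have *: "(\<lambda>j. ((s ^ j / fact j) *\<^sub>R (A ^^ j) x) \<bullet> b) = (\<lambda>j. ((A ^^ j) x \<bullet> b / fact j) * s ^ j)"
      by (auto simp: fun_eq_iff)
    show "op_exp (\<lambda>w. s *\<^sub>R A w) x \<bullet> b = (\<Sum>j. ((A ^^ j) x \<bullet> b / fact j) * s ^ j)"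
      unfolding op_exp_scaled[OF lin]
      using bounded_linear.suminf[OF bounded_linear_inner_left[of b] summable_op_exp[OF lin, of s x]] *
      by simp
    show "summable (\<lambda>j. ((A ^^ j) x \<bullet> b / fact j) * s ^ j)"
      using bounded_linear.summable[OF bounded_linear_inner_left[of b] summable_op_exp[OF lin, of s x]] *
      by simp
  qed
  have comm: "A (op_exp (\<lambda>w. t *\<^sub>R A w) v) = op_exp (\<lambda>w. t *\<^sub>R A w) (A v)"
    by (rule op_exp_intertwine) (use lin in \<open>auto intro!: linear_compose_scale_right simp: linear_scale\<close>)
  \<comment> \<open>The factor \<open>j + 1\<close> from differentiation reduces
    \<open>fact (j + 1)\<close> to \<open>fact j\<close>; the surplus application of
    \<open>A\<close> is absorbed into the starting vector.\<close>
  have shift: "diffs (\<lambda>j. (A ^^ j) v \<bullet> b / fact j) = (\<lambda>j. (A ^^ j) (A v) \<bullet> b / fact j)" for b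
    by (auto simp: diffs_def fun_eq_iff funpow_swap1 divide_simps)
  have "((\<lambda>t. op_exp (\<lambda>w. t *\<^sub>R A w) v \<bullet> b) has_real_derivative
           A (op_exp (\<lambda>w. t *\<^sub>R A w) v) \<bullet> b) (at t)" for b
    using termdiffs_strong_converges_everywhere[of "\<lambda>j. (A ^^ j) v \<bullet> b / fact j" t] summ
    unfolding comp comm shift by simp
  then show ?thesis
    unfolding has_vector_derivative_def
    by (subst has_derivative_componentwise_within)
       (auto simp: has_field_derivative_def mult.commute[of _ "_ \<bullet> _"] mult_commute_abs)
qed

lemma op_exp_zero: "op_exp (\<lambda>w. 0) v = (v :: complex ^ 'n)"
proof -
  have "((\<lambda>w. 0) ^^ j) v = (if j = 0 then v else 0)" for j
    by (cases j) auto
  then have "op_exp (\<lambda>w. 0) v = (\<Sum>j. if j = 0 then v else 0)"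
    unfolding op_exp_def by (intro suminf_cong) auto
  also have "\<dots> = v"
    using suminf_finite[of "{0}" "\<lambda>j. if j = 0 then v else 0"] by simp
  finally show ?thesis .
qed

text \<open>The derivative of \<open>u t \<bullet> u t\<close> is twice
  \<open>u t \<bullet> A (u t)\<close>, which vanishes. Besides isometry this gives uniqueness for
  the flow: a difference of two solutions that is zero at time 0 stays zero.\<close>

lemma skew_flow_norm:
  fixes A :: "'a::real_inner \<Rightarrow> 'a"
  assumes skew: "\<And>x. x \<bullet> A x = 0"
    and deriv: "\<And>t. (u has_vector_derivative A (u t)) (at t)"
  shows "norm (u t) = norm (u 0)"
proof -
  have "((\<lambda>t. u t \<bullet> u t) has_real_derivative 0) (at t)" for t
    unfolding has_field_derivative_def
    by (rule has_derivative_eq_rhs, rule has_derivative_inner[OF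
          deriv[unfolded has_vector_derivative_def] deriv[unfolded has_vector_derivative_def]])
       (auto simp: skew inner_commute)
  then have "u t \<bullet> u t = u 0 \<bullet> u 0"
    using DERIV_isconst_all[of "\<lambda>t. u t \<bullet> u t"] by blast
  then show ?thesis
    by (simp add: norm_eq_sqrt_inner)
qed

lemma norm_op_exp_skew:
  fixes A :: "complex ^ 'n \<Rightarrow> complex ^ 'n"
  assumes "linear A" and "\<And>x. x \<bullet> A x = 0"
  shows "norm (op_exp A v) = norm v"
  using skew_flow_norm[of A "\<lambda>t. op_exp (\<lambda>w. t *\<^sub>R A w) v" 1]
    op_exp_has_vector_derivative[OF assms(1)] assms(2)
  by (simp add: op_exp_zero)

text \<open>Both sides, with \<open>A\<close> replaced by \<open>t A\<close> and \<open>\<theta>\<close> by \<open>t \<theta>\<close>, solve \<open>w' = A w\<close> with the same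
  initial value.\<close>

lemma op_exp_rotation:
  fixes A X Y :: "complex ^ 'n \<Rightarrow> complex ^ 'n"
  assumes A: "linear A" and skew: "\<And>x. x \<bullet> A x = 0"
    and X: "linear X" and Y: "linear Y"
    and AX: "\<And>x. A (X x) = X (A x) - \<theta> *\<^sub>R Y x"
    and AY: "\<And>x. A (Y x) = Y (A x) + \<theta> *\<^sub>R X x"
  shows "cos \<theta> *\<^sub>R X (op_exp A v) - sin \<theta> *\<^sub>R Y (op_exp A v) = op_exp A (X v)"
proof -
  define u where "u t = op_exp (\<lambda>w. t *\<^sub>R A w) v" for t
  define d where "d t = cos (\<theta> * t) *\<^sub>R X (u t) - sin (\<theta> * t) *\<^sub>R Y (u t)
    - op_exp (\<lambda>w. t *\<^sub>R A w) (X v)" for t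
  note du = op_exp_has_vector_derivative[OF A]
  have bl: "bounded_linear X" "bounded_linear Y"
    using X Y by (simp_all add: linear_linear)
  have dX: "((\<lambda>t. X (u t)) has_vector_derivative X (A (u t))) (at t)"
    and dY: "((\<lambda>t. Y (u t)) has_vector_derivative Y (A (u t))) (at t)" for t
    unfolding u_def by (rule bl[THEN bounded_linear.has_vector_derivative, OF du])+
  have "(d has_vector_derivative A (d t)) (at t)" for t
  proof -
    have "(d has_vector_derivative
        (cos (\<theta> * t) *\<^sub>R X (A (u t)) + (- sin (\<theta> * t) * \<theta>) *\<^sub>R X (u t)
         - (sin (\<theta> * t) *\<^sub>R Y (A (u t)) + (cos (\<theta> * t) * \<theta>) *\<^sub>R Y (u t))
         - A (op_exp (\<lambda>w. t *\<^sub>R A w) (X v)))) (at t)"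
      unfolding d_def
      by (intro has_vector_derivative_diff has_vector_derivative_scaleR dX dY du)
         (auto intro!: derivative_eq_intros)
    also have "cos (\<theta> * t) *\<^sub>R X (A (u t)) + (- sin (\<theta> * t) * \<theta>) *\<^sub>R X (u t)
         - (sin (\<theta> * t) *\<^sub>R Y (A (u t)) + (cos (\<theta> * t) * \<theta>) *\<^sub>R Y (u t))
         - A (op_exp (\<lambda>w. t *\<^sub>R A w) (X v)) = A (d t)"
      unfolding d_def
      by (simp add: linear_add[OF A] linear_diff[OF A] linear_scale[OF A] AX AY algebra_simps)
    finally show ?thesis .
  qed
  from skew_flow_norm[OF skew this, of 1] have "norm (d 1) = norm (d 0)"
    by simp
  then have "d 1 = 0"
    by (simp add: d_def u_def op_exp_zero)
  then show ?thesis
    by (simp add: d_def u_def)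
qed

subsection \<open>Operators diagonal in a rotated basis\<close>

lemma clinear_isometry_bij:
  assumes "clinear V" and "\<And>v. norm (V v) = norm v"
  shows "bij V"
proof -
  have lin: "linear V"
    using assms(1) by (rule clinear_imp_linear)
  have "inj V"
    unfolding linear_injective_0[OF lin] using assms(2) by (metis norm_eq_zero)
  then show ?thesis
    using linear_injective_imp_surjective[OF lin] by (auto simp: bij_def)
qed

text \<open>Subtracting \<open>z\<close> from \<open>H\<close> and applying the result to
  \<open>V v\<close> gives the image under \<open>V\<close> of the vector with coordinates
  \<open>(\<epsilon> i - z) * v $ i\<close>. Since \<open>V\<close> preserves norms, each of these
  coordinates must vanish.\<close>

lemma diagonalized_kernel:
  assumes V: "clinear V" "\<And>v. norm (V v) = norm v" and H: "clinear H"
    and diag: "\<And>n. H (V (axis n 1)) = \<epsilon> n *s V (axis n 1)"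
    and "H (V v) = z *s V v" and "v $ n \<noteq> 0"
  shows "\<epsilon> n = z"
proof -
  have "H (V v) = (\<Sum>i\<in>UNIV. (v $ i * \<epsilon> i) *s V (axis i 1))"
    unfolding clinear_expand[OF V(1), of v]
    by (simp add: vec.linear_sum[OF H] vec.linear_scale[OF H] diag)
  moreover have "z *s V v = (\<Sum>i\<in>UNIV. (v $ i * z) *s V (axis i 1))"
    unfolding clinear_expand[OF V(1), of v] by (simp add: vec.scale_sum_right mult.commute)
  ultimately have "H (V v) - z *s V v = (\<Sum>i\<in>UNIV. ((\<epsilon> i - z) * v $ i) *s V (axis i 1))"
    by (simp add: vec.scale_left_diff_distrib algebra_simps sum_subtractf)
  also have "\<dots> = V (\<chi> i. (\<epsilon> i - z) * v $ i)"
    by (simp add: clinear_expand[OF V(1), of "\<chi> i. (\<epsilon> i - z) * v $ i"])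
  finally have "norm (\<chi> i. (\<epsilon> i - z) * v $ i) = 0"
    using assms(5) V(2) by (metis norm_zero right_minus_eq)
  then show ?thesis
    using assms(6) by (auto simp: vec_eq_iff)
qed

lemma diagonalized_eigenvalue_iff:
  assumes V: "clinear V" "\<And>v. norm (V v) = norm v" and H: "clinear H"
    and diag: "\<And>n. H (V (axis n 1)) = \<epsilon> n *s V (axis n 1)"
  shows "op_eigenvalue H z \<longleftrightarrow> (\<exists>n. z = \<epsilon> n)"
proof
  assume "op_eigenvalue H z"
  then obtain w where w: "w \<noteq> 0" "H w = z *s w"
    by (auto simp: op_eigenvalue_def)
  obtain v where v: "w = V v"
    using clinear_isometry_bij[OF V] by (metis bij_pointE)
  with w(1) V have "v \<noteq> 0"
    by (metis norm_eq_zero)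
  then obtain n where "v $ n \<noteq> 0"
    by (auto simp: vec_eq_iff)
  with diagonalized_kernel[OF assms] w v show "\<exists>n. z = \<epsilon> n"
    by metis
next
  assume "\<exists>n. z = \<epsilon> n"
  then obtain n where "z = \<epsilon> n" ..
  moreover have "norm (V (axis n 1)) = 1"
    by (simp add: V(2))
  ultimately show "op_eigenvalue H z"
    unfolding op_eigenvalue_def using diag by (metis norm_zero zero_neq_one)
qed

text \<open>In finite dimension an injective linear endomorphism is bijective, so bijectivity fails
  exactly when there is a nonzero kernel vector.\<close>

lemma op_spectrum_eq_eigenvalues:
  assumes "clinear H"
  shows "op_spectrum H = {z. op_eigenvalue H z}"
proof -
  have "bij (\<lambda>v. H v - z *s v) \<longleftrightarrow> \<not> op_eigenvalue H z" for z
  proof -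
    have lin: "linear (\<lambda>v. H v - z *s v)"
      by (intro clinear_imp_linear clinearI)
         (simp_all add: vec.linear_add[OF assms] vec.linear_scale[OF assms]
            vec.scale_right_distrib vec.scale_right_diff_distrib mult.commute)
    have "bij (\<lambda>v. H v - z *s v) \<longleftrightarrow> inj (\<lambda>v. H v - z *s v)"
      using linear_injective_imp_surjective[OF lin] by (auto simp: bij_def)
    then show ?thesis
      unfolding linear_injective_0[OF lin] op_eigenvalue_def by auto
  qed
  then show ?thesis
    by (auto simp: op_spectrum_def)
qed

lemma diagonalized_ground_state_energy:
  assumes V: "clinear V" "\<And>v. norm (V v) = norm v" and H: "clinear H"
    and diag: "\<And>n. H (V (axis n 1)) = complex_of_real (\<epsilon> n) *s V (axis n 1)"
    and min: "\<And>n. \<epsilon> n0 \<le> \<epsilon> n"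
  shows "ground_state_energy H = \<epsilon> n0"
  unfolding ground_state_energy_def diagonalized_eigenvalue_iff[OF V H diag]
  by (intro Least_equality) (use min in auto)

lemma diagonalized_ground_state:
  assumes V: "clinear V" "\<And>v. norm (V v) = norm v" and H: "clinear H" "selfadjoint H"
    and diag: "\<And>n. H (V (axis n 1)) = complex_of_real (\<epsilon> n) *s V (axis n 1)"
    and min: "\<And>n. \<epsilon> n0 \<le> \<epsilon> n"
  shows "is_ground_state H (V (axis n0 1))"
  unfolding is_ground_state_def diagonalized_eigenvalue_iff[OF V H(1) diag]
  using H(2) V(2) diag min by auto

text \<open>A nonzero coordinate at some \<open>n\<close> other than \<open>n0\<close> would force
  the eigenvalue to be \<open>\<epsilon> n\<close>, which is strictly above
  \<open>\<epsilon> n0\<close>. Hence only the coordinate at \<open>n0\<close> survives, and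
  normalization makes it a phase.\<close>

lemma diagonalized_ground_state_unique:
  assumes V: "clinear V" "\<And>v. norm (V v) = norm v" and H: "clinear H"
    and diag: "\<And>n. H (V (axis n 1)) = complex_of_real (\<epsilon> n) *s V (axis n 1)"
    and min: "\<And>n. n \<noteq> n0 \<Longrightarrow> \<epsilon> n0 < \<epsilon> n"
    and "is_ground_state H \<phi>"
  shows "\<exists>c. cmod c = 1 \<and> \<phi> = c *s V (axis n0 1)"
proof -
  note ev = diagonalized_eigenvalue_iff[OF V H diag]
  from assms(6) obtain E where E: "norm \<phi> = 1" "H \<phi> = complex_of_real E *s \<phi>"
    "\<And>n. E \<le> \<epsilon> n"
    unfolding is_ground_state_def ev by auto
  obtain v where v: "\<phi> = V v"
    using clinear_isometry_bij[OF V] by (metis bij_pointE)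
  have "v $ n = 0" if "n \<noteq> n0" for n
  proof (rule ccontr)
    assume "v $ n \<noteq> 0"
    then have "complex_of_real (\<epsilon> n) = complex_of_real E"
      using diagonalized_kernel[OF V H diag] E(2) v by blast
    with E(3)[of n0] min[OF that] show False
      by simp
  qed
  then have ax: "v = v $ n0 *s axis n0 1"
    by (simp add: vec_eq_iff axis_def)
  have "norm (v $ n0 *s axis n0 1 :: complex ^ 'a) = cmod (v $ n0)"
    by (simp add: norm_vec_def L2_set_def axis_def if_distrib[of "\<lambda>x. x ^ 2"]
          if_distrib[of norm] if_distrib[of "\<lambda>x. _ * x"] cong: if_cong)
  with ax E(1) v V(2) have "cmod (v $ n0) = 1"
    by metis
  moreover have "\<phi> = v $ n0 *s V (axis n0 1)"
    using ax v vec.linear_scale[OF V(1)] by metis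
  ultimately show ?thesis
    by blast
qed

subsection \<open>Canonical anticommutation relations\<close>

text \<open>Coordinate form of \<open>annih\<close>, indexed by the mode alone. Component
  \<open>n\<close> of the image comes from the basis vector with \<open>a\<close> filled, so the
  test on \<open>n a\<close> is opposite to the one in \<open>annih\<close>.\<close>

definition ann :: "'q::{finite,linorder} \<times> spin \<Rightarrow> 'q fock \<Rightarrow> 'q fock" where
  "ann a v = (\<chi> n. if n a then 0 else occ_sign a n * v $ n(a := True))"

definition cre :: "'q::{finite,linorder} \<times> spin \<Rightarrow> 'q fock \<Rightarrow> 'q fock" where
  "cre a v = (\<chi> n. if n a then occ_sign a n * v $ n(a := False) else 0)"

lemma left_of_irrefl: "\<not> left_of a a"
  by (auto simp: left_of_def)

lemma left_of_total: "a \<noteq> b \<Longrightarrow> left_of a b \<or> left_of b a"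
  by (cases a; cases b; cases "snd a"; cases "snd b") (auto simp: left_of_def)

lemma left_of_asym: "left_of a b \<Longrightarrow> \<not> left_of b a"
  by (auto simp: left_of_def)

lemma occ_sign_upd_other: "\<not> left_of b a \<Longrightarrow> occ_sign a (n(b := x)) = occ_sign a n"
  unfolding occ_sign_def by (rule arg_cong[where f = "\<lambda>A. (-1) ^ card A"]) auto

lemma occ_sign_upd_same: "occ_sign a (n(a := x)) = occ_sign a n"
  by (simp add: occ_sign_upd_other left_of_irrefl)

lemma occ_sign_upd_left:
  assumes "left_of b a"
  shows "occ_sign a (n(b := True)) = - occ_sign a (n(b := False))"
proof -
  have "{c. left_of c a \<and> (n(b := True)) c} = insert b {c. left_of c a \<and> (n(b := False)) c}"
    using assms by auto
  then show ?thesis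
    unfolding occ_sign_def by simp
qed

lemma occ_sign_upd:
  assumes "left_of b a"
  shows "occ_sign a (n(b := x)) = (if n b = x then occ_sign a n else - occ_sign a n)"
  using occ_sign_upd_left[OF assms, of n]
  by (cases x; cases "n b") (auto simp: fun_upd_idem)

text \<open>The source of every minus sign in the anticommutation relations. Of two distinct modes
  exactly one lies to the left of the other; flipping the left one reverses the sign attached to the
  right one, while flipping the right one changes nothing. The hypotheses on \<open>x\<close> and
  \<open>y\<close> say that both updates are flips.\<close>

lemma occ_sign_swap:
  assumes "a \<noteq> b" "n a \<noteq> x" "n b \<noteq> y"
  shows "occ_sign a n * (occ_sign b (n(a := x)) * z) = - (occ_sign b n * (occ_sign a (n(b := y)) * z))"
proof (cases "left_of a b")
  case True
  then show ?thesis
    using assms by (simp add: occ_sign_upd occ_sign_upd_other[OF left_of_asym])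
next
  case False
  then have "left_of b a"
    using left_of_total assms(1) by blast
  then show ?thesis
    using assms by (simp add: occ_sign_upd occ_sign_upd_other[OF left_of_asym])
qed

lemma occ_sign_square: "occ_sign a n * (occ_sign a n * z) = z"
  by (simp add: occ_sign_def flip: mult.assoc power_add mult_2)

lemma cnj_occ_sign: "cnj (occ_sign a n) = occ_sign a n"
  by (simp add: occ_sign_def)

lemma ann_ann_same: "ann a (ann a v) = 0"
  and cre_cre_same: "cre a (cre a v) = 0"
  by (simp_all add: ann_def cre_def vec_eq_iff)

lemma ann_cre_same: "ann a (cre a v) = v - cre a (ann a v)"
  by (auto simp: ann_def cre_def vec_eq_iff occ_sign_upd_same occ_sign_square fun_upd_idem)

lemma ann_ann_swap: "a \<noteq> b \<Longrightarrow> ann a (ann b v) = - ann b (ann a v)"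
  by (auto simp: ann_def vec_eq_iff fun_upd_twist occ_sign_swap[of a b _ True True])

lemma cre_cre_swap: "a \<noteq> b \<Longrightarrow> cre a (cre b v) = - cre b (cre a v)"
  by (auto simp: cre_def vec_eq_iff fun_upd_twist occ_sign_swap[of a b _ False False])

lemma ann_cre_swap: "a \<noteq> b \<Longrightarrow> ann a (cre b v) = - cre b (ann a v)"
  by (auto simp: ann_def cre_def vec_eq_iff fun_upd_twist occ_sign_swap[of a b _ True False])

lemma clinear_ann: "clinear (ann a)"
  and clinear_cre: "clinear (cre a)"
  by (auto intro!: clinearI simp: ann_def cre_def vec_eq_iff algebra_simps)

lemmas mode_linear_simps =
  vec.linear_add[OF clinear_ann] vec.linear_diff[OF clinear_ann] vec.linear_neg[OF clinear_ann]
  vec.linear_scale[OF clinear_ann] vec.linear_0[OF clinear_ann] vec.linear_sum[OF clinear_ann]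
  linear_scale[OF clinear_imp_linear[OF clinear_ann]]
  vec.linear_add[OF clinear_cre] vec.linear_diff[OF clinear_cre] vec.linear_neg[OF clinear_cre]
  vec.linear_scale[OF clinear_cre] vec.linear_0[OF clinear_cre] vec.linear_sum[OF clinear_cre]
  linear_scale[OF clinear_imp_linear[OF clinear_cre]]

text \<open>Filling \<open>a\<close> is a bijection from the configurations with \<open>a\<close>
  empty to those with \<open>a\<close> occupied. Reindexing along it matches the two sums, because
  the sign is real and independent of the occupation of \<open>a\<close> itself.\<close>

lemma cinner_ann: "cinner (ann a x) y = cinner x (cre a y)"
proof -
  have "bij_betw (\<lambda>n. n(a := True)) {n. \<not> n a} {n. n a}"
    by (rule bij_betwI[where g = "\<lambda>n. n(a := False)"]) (auto simp: fun_upd_idem)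
  then have "(\<Sum>n | \<not> n a. cnj (x $ n(a := True)) * (occ_sign a n * y $ n))
      = (\<Sum>n | n a. cnj (x $ n) * (occ_sign a n * y $ n(a := False)))"
    by (rule sum.reindex_bij_betw_not_neutral[of "{}" "{}", simplified, THEN trans[rotated]])
       (auto intro!: sum.cong simp: occ_sign_upd_same fun_upd_idem)
  then show ?thesis
    unfolding cinner_def ann_def cre_def
    by (simp add: if_distrib[of cnj] if_distrib[of "\<lambda>x. x * _"] if_distrib[of "\<lambda>x. _ * x"]
        sum.If_cases Collect_neg_eq[symmetric] cnj_occ_sign mult_ac cong: if_cong)
qed

lemma cinner_cre: "cinner (cre a x) y = cinner x (ann a y)"
proof -
  have "cinner x y = cnj (cinner y x)" for x y :: "'a fock"
    by (simp add: cinner_def mult.commute)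
  then show ?thesis
    by (metis cinner_ann complex_cnj_cnj)
qed

lemma ann_axis: "ann a (axis n 1) = (if n a then occ_sign a n *s axis (n(a := False)) 1 else 0)"
  by (auto simp: ann_def axis_def vec_eq_iff occ_sign_upd_same fun_upd_idem)

lemma cre_axis: "cre a (axis n 1) = (if n a then 0 else occ_sign a n *s axis (n(a := True)) 1)"
  by (auto simp: cre_def axis_def vec_eq_iff occ_sign_upd_same fun_upd_idem)

lemma annih_eq_ann: "annih lab k \<sigma> = ann (lab k, \<sigma>)"
  by (rule ext, subst clinear_expand[OF clinear_ann]) (simp add: annih_def ann_axis)

lemma creat_eq_cre: "creat lab k \<sigma> = cre (lab k, \<sigma>)"
  by (rule ext, subst clinear_expand[OF clinear_cre]) (simp add: creat_def cre_axis)

lemma number_axis: "cre a (ann a (axis n 1)) = of_bool (n a) *s axis n 1"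
  by (auto simp: ann_axis cre_axis mode_linear_simps occ_sign_upd_same fun_upd_idem
      occ_sign_square[of _ _ 1, simplified])

subsection \<open>Pair operators\<close>

definition pair_skew :: "'q::{finite,linorder} \<times> spin \<Rightarrow> 'q \<times> spin \<Rightarrow> 'q fock \<Rightarrow> 'q fock" where
  "pair_skew a b v = cre a (cre b v) - ann b (ann a v)"

definition pair_sym :: "'q::{finite,linorder} \<times> spin \<Rightarrow> 'q \<times> spin \<Rightarrow> 'q fock \<Rightarrow> 'q fock" where
  "pair_sym a b v = ann b (ann a v) + cre a (cre b v)"

definition pair_num :: "'q::{finite,linorder} \<times> spin \<Rightarrow> 'q \<times> spin \<Rightarrow> 'q fock \<Rightarrow> 'q fock" where
  "pair_num a b v = cre a (ann a v) + cre b (ann b v) - v"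

lemma clinear_pair_skew: "clinear (pair_skew a b)"
  and clinear_pair_sym: "clinear (pair_sym a b)"
  and clinear_pair_num: "clinear (pair_num a b)"
  by (auto intro!: clinearI simp: pair_skew_def pair_sym_def pair_num_def mode_linear_simps
      vec.scale_right_distrib vec.scale_right_diff_distrib)

lemma pair_skew_num:
  assumes "a \<noteq> b"
  shows "pair_skew a b (pair_num a b v) = pair_num a b (pair_skew a b v) - 2 *\<^sub>R pair_sym a b v"
proof -
  \<comment> \<open>Oriented towards a normal form: creators to the left of annihilators, and
    \<open>a\<close> to the left of \<open>b\<close> within each kind.\<close>
  note swap = ann_ann_swap[OF assms[symmetric]] cre_cre_swap[OF assms[symmetric]]
    ann_cre_swap[OF assms] ann_cre_swap[OF assms[symmetric]]
  show ?thesis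
    by (simp add: pair_skew_def pair_sym_def pair_num_def mode_linear_simps swap
        ann_cre_same ann_ann_same cre_cre_same scaleR_2)
qed

lemma pair_skew_sym:
  assumes "a \<noteq> b"
  shows "pair_skew a b (pair_sym a b v) = pair_sym a b (pair_skew a b v) + 2 *\<^sub>R pair_num a b v"
proof -
  note swap = ann_ann_swap[OF assms[symmetric]] cre_cre_swap[OF assms[symmetric]]
    ann_cre_swap[OF assms] ann_cre_swap[OF assms[symmetric]]
  show ?thesis
    by (simp add: pair_skew_def pair_sym_def pair_num_def mode_linear_simps swap
        ann_cre_same ann_ann_same cre_cre_same scaleR_2)
qed

text \<open>Each term is quadratic in the mode operators (or the identity), so moving one past
  another on disjoint modes costs an even number of sign changes.\<close>

lemma
  assumes "c \<noteq> a" "c \<noteq> b" "d \<noteq> a" "d \<noteq> b"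
  shows pair_skew_num_disjoint: "pair_skew c d (pair_num a b v) = pair_num a b (pair_skew c d v)"
    and pair_skew_sym_disjoint: "pair_skew c d (pair_sym a b v) = pair_sym a b (pair_skew c d v)"
  using assms
  by (simp_all add: pair_skew_def pair_sym_def pair_num_def mode_linear_simps
      ann_ann_swap[of c a] ann_ann_swap[of c b] ann_ann_swap[of d a] ann_ann_swap[of d b]
      cre_cre_swap[of c a] cre_cre_swap[of c b] cre_cre_swap[of d a] cre_cre_swap[of d b]
      ann_cre_swap[of c a] ann_cre_swap[of c b] ann_cre_swap[of d a] ann_cre_swap[of d b]
      ann_cre_swap[of a c] ann_cre_swap[of b c] ann_cre_swap[of a d] ann_cre_swap[of b d])

text \<open>The two terms of \<open>pair_skew\<close> are adjoint to each other, so their difference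
  has vanishing real quadratic form.\<close>

lemma inner_pair_skew: "x \<bullet> pair_skew a b x = 0"
proof -
  have "cinner (ann b (ann a x)) x = cinner x (cre a (cre b x))"
    by (simp add: cinner_ann)
  then have "x \<bullet> cre a (cre b x) = x \<bullet> ann b (ann a x)"
    by (metis Re_cinner inner_commute)
  then show ?thesis
    by (simp add: pair_skew_def inner_diff_right)
qed

subsection \<open>Vectors with real coordinates\<close>

text \<open>The additive constant of \<open>H_M\<close> is a complex number built from expectations
  in \<open>Psi\<close>. It is real because all operators involved have real matrix entries in the
  occupation basis, so \<open>Psi\<close> has real coordinates.\<close>

definition real_vec :: "complex ^ 'n \<Rightarrow> bool" where
  "real_vec v \<longleftrightarrow> (\<forall>i. v $ i \<in> \<real>)"

lemma real_vec_scaleR: "real_vec v \<Longrightarrow> real_vec (r *\<^sub>R v)"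
  unfolding real_vec_def vector_scaleR_component by (simp add: scaleR_conv_of_real)

lemma real_vec_add: "real_vec v \<Longrightarrow> real_vec w \<Longrightarrow> real_vec (v + w)"
  and real_vec_diff: "real_vec v \<Longrightarrow> real_vec w \<Longrightarrow> real_vec (v - w)"
  and real_vec_axis: "real_vec (axis i 1)"
  by (auto simp: real_vec_def axis_def)

lemma real_vec_sum: "(\<And>i. i \<in> A \<Longrightarrow> real_vec (f i)) \<Longrightarrow> real_vec (sum f A)"
  by (auto simp: real_vec_def)

lemma cinner_real_vec: "real_vec v \<Longrightarrow> real_vec w \<Longrightarrow> cinner v w \<in> \<real>"
  by (auto simp: real_vec_def cinner_def Reals_cnj_iff)

lemma real_vec_ann: "real_vec v \<Longrightarrow> real_vec (ann a v)"
  and real_vec_cre: "real_vec v \<Longrightarrow> real_vec (cre a v)"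
  by (auto simp: real_vec_def ann_def cre_def occ_sign_def)

text \<open>Every term of the series has real coordinates, and the imaginary part of a coordinate is
  a bounded real-linear functional, so it passes through the sum.\<close>

lemma real_vec_op_exp:
  fixes A :: "complex ^ 'n \<Rightarrow> complex ^ 'n"
  assumes "linear A" "\<And>v. real_vec v \<Longrightarrow> real_vec (A v)" "real_vec v"
  shows "real_vec (op_exp A v)"
proof -
  have "real_vec ((1 / fact j) *\<^sub>R (A ^^ j) v)" for j
    by (intro real_vec_scaleR, induction j) (auto simp: assms)
  then have "Im (((1 / fact j) *\<^sub>R (A ^^ j) v) $ i) = 0" for i j
    unfolding real_vec_def complex_is_Real_iff by blast
  moreover have "bounded_linear (\<lambda>v :: complex ^ 'n. Im (v $ i))" for i
    by (intro bounded_linear_compose[OF bounded_linear_Im] bounded_linear_vec_nth)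
  ultimately have "Im (op_exp A v $ i) = 0" for i
    unfolding op_exp_def
    using bounded_linear.suminf[of "\<lambda>v. Im (v $ i)", OF _ summable_op_exp'[OF assms(1)], of v]
    by simp
  then show ?thesis
    by (simp add: real_vec_def complex_is_Real_iff)
qed

lemma real_vec_op_adjoint:
  assumes "clinear T" "\<And>v. real_vec v \<Longrightarrow> real_vec (T v)" "real_vec v"
  shows "real_vec (op_adjoint T v)"
  unfolding real_vec_def op_adjoint_component[OF assms(1)]
  by (intro allI cinner_real_vec assms real_vec_axis)

subsection \<open>The Bogoliubov rotation\<close>

locale momentum_lattice =
  fixes \<Lambda> :: "(real ^ 3) set" and lab :: "real ^ 3 \<Rightarrow> 'q::{finite,linorder}"
  assumes bij_lab: "bij_betw lab \<Lambda> UNIV"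
    and neg_closed: "k \<in> \<Lambda> \<Longrightarrow> - k \<in> \<Lambda>"
begin

abbreviation up :: "real ^ 3 \<Rightarrow> 'q \<times> spin" where
  "up k \<equiv> (lab k, Up)"

abbreviation down_neg :: "real ^ 3 \<Rightarrow> 'q \<times> spin" where
  "down_neg k \<equiv> (lab (- k), Down)"

definition gen :: "(real ^ 3 \<Rightarrow> real) \<Rightarrow> 'q fock \<Rightarrow> 'q fock" where
  "gen \<theta> v = (\<Sum>k\<in>\<Lambda>. \<theta> k *\<^sub>R pair_skew (up k) (down_neg k) v)"

abbreviation rot :: "(real ^ 3 \<Rightarrow> real) \<Rightarrow> 'q fock \<Rightarrow> 'q fock" where
  "rot \<theta> \<equiv> op_exp (gen \<theta>)"

lemma finite_momenta: "finite \<Lambda>"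
  using bij_betw_finite[OF bij_lab] by simp

lemma lab_eq_iff: "k \<in> \<Lambda> \<Longrightarrow> k' \<in> \<Lambda> \<Longrightarrow> lab k = lab k' \<longleftrightarrow> k = k'"
  using bij_betw_imp_inj_on[OF bij_lab] by (simp add: inj_on_eq_iff)

lemma sum_neg: "(\<Sum>k\<in>\<Lambda>. f (- k)) = (\<Sum>k\<in>\<Lambda>. f k)"
  by (rule sum.reindex_bij_witness[of _ uminus uminus]) (auto simp: neg_closed)

lemma gen_eq_minus:
  "gen \<theta> v = - (\<Sum>k\<in>\<Lambda>. \<theta> k *\<^sub>R (annih lab (- k) Down (annih lab k Up v)
    - creat lab k Up (creat lab (- k) Down v)))"
  unfolding gen_def pair_skew_def annih_eq_ann creat_eq_cre sum_negf[symmetric]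
    scaleR_minus_right[symmetric] minus_diff_eq ..

text \<open>The two factors \<open>\<i>\<close> multiply to -1, which leaves a generator with real
  coefficients.\<close>

lemma i_G_B_eq_gen: "(\<lambda>v. \<i> *s G_B \<Lambda> lab \<theta> v) = gen \<theta>"
  unfolding G_B_def gen_eq_minus vec.scale_scale by simp

lemma neg_i_G_B_eq_gen: "(\<lambda>v. (- \<i>) *s G_B \<Lambda> lab \<theta> v) = gen (\<lambda>k. - \<theta> k)"
  unfolding G_B_def gen_eq_minus vec.scale_scale by (simp add: sum_negf)

lemma clinear_gen: "clinear (gen \<theta>)"
  by (rule clinearI)
     (simp_all add: gen_def vec.linear_add[OF clinear_pair_skew] vec.linear_scale[OF clinear_pair_skew]
       scaleR_add_right sum.distrib vec.scale_sum_right scaleR_eq_smult mult.commute)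

lemmas linear_gen = clinear_imp_linear[OF clinear_gen]

lemma inner_gen: "x \<bullet> gen \<theta> x = 0"
  by (simp add: gen_def inner_sum_right inner_pair_skew)

lemma clinear_rot: "clinear (rot \<theta>)"
  by (rule clinear_op_exp[OF clinear_gen])

lemma norm_rot: "norm (rot \<theta> v) = norm v"
  by (rule norm_op_exp_skew[OF linear_gen inner_gen])

text \<open>Distinct momenta give pairs with no common mode: \<open>up\<close> and
  \<open>down_neg\<close> differ in spin, and negation is injective. Hence only the summand at
  \<open>k\<close> contributes to the commutator.\<close>

lemma gen_commutator:
  assumes k: "k \<in> \<Lambda>" and X: "linear X"
    and eq: "\<And>v. pair_skew (up k) (down_neg k) (X v) = X (pair_skew (up k) (down_neg k) v) + 2 *\<^sub>R Y v"
    and neq: "\<And>a b v. up k \<noteq> a \<Longrightarrow> up k \<noteq> b \<Longrightarrow> down_neg k \<noteq> a \<Longrightarrow> down_neg k \<noteq> b \<Longrightarrow>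
      pair_skew a b (X v) = X (pair_skew a b v)"
  shows "gen \<theta> (X v) = X (gen \<theta> v) + (2 * \<theta> k) *\<^sub>R Y v"
proof -
  have "\<theta> k' *\<^sub>R pair_skew (up k') (down_neg k') (X v)
      = X (\<theta> k' *\<^sub>R pair_skew (up k') (down_neg k') v)
        + (if k' = k then (2 * \<theta> k) *\<^sub>R Y v else 0)" if "k' \<in> \<Lambda>" for k'
  proof (cases "k' = k")
    case True
    then show ?thesis
      by (simp add: eq scaleR_add_right linear_scale[OF X] mult.commute)
  next
    case False
    then have "lab k \<noteq> lab k'" "lab (- k) \<noteq> lab (- k')"
      using lab_eq_iff k that neg_closed by auto
    then show ?thesis
      using False by (simp add: neq linear_scale[OF X])
  qed
  then show ?thesis
    unfolding gen_def
    by (simp add: sum.distrib linear_sum[OF X] sum.delta[OF finite_momenta] k)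
qed

lemma rot_pair_num:
  assumes k: "k \<in> \<Lambda>"
  shows "cos (2 * \<theta> k) *\<^sub>R pair_num (up k) (down_neg k) (rot \<theta> v)
      - sin (2 * \<theta> k) *\<^sub>R pair_sym (up k) (down_neg k) (rot \<theta> v)
      = rot \<theta> (pair_num (up k) (down_neg k) v)"
proof (rule op_exp_rotation[OF linear_gen inner_gen])
  show num: "linear (pair_num (up k) (down_neg k))" and sym: "linear (pair_sym (up k) (down_neg k))"
    by (simp_all add: clinear_imp_linear clinear_pair_num clinear_pair_sym)
  show "gen \<theta> (pair_num (up k) (down_neg k) x)
      = pair_num (up k) (down_neg k) (gen \<theta> x) - (2 * \<theta> k) *\<^sub>R pair_sym (up k) (down_neg k) x" for x
    \<comment> \<open>The minus sign of this commutator is absorbed by taking \<open>Y\<close> to be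
      the negative of \<open>pair_sym\<close>.\<close>
    using gen_commutator[OF k num, of "\<lambda>v. - pair_sym (up k) (down_neg k) v"]
    by (simp add: pair_skew_num pair_skew_num_disjoint)
  show "gen \<theta> (pair_sym (up k) (down_neg k) x)
      = pair_sym (up k) (down_neg k) (gen \<theta> x) + (2 * \<theta> k) *\<^sub>R pair_num (up k) (down_neg k) x" for x
    by (rule gen_commutator[OF k sym]) (simp_all add: pair_skew_sym pair_skew_sym_disjoint)
qed

lemma Psi_BCS_eq_rot: "Psi_BCS \<Lambda> lab \<theta> = rot \<theta> (axis (\<lambda>_. False) 1)"
  by (simp add: Psi_BCS_def i_G_B_eq_gen vacuum_def)

subsection \<open>The constant in the mean field Hamiltonian is real\<close>

lemma real_vec_rot: "real_vec v \<Longrightarrow> real_vec (rot \<theta> v)"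
  by (rule real_vec_op_exp[OF linear_gen])
     (auto simp: gen_def pair_skew_def intro!: real_vec_sum real_vec_scaleR real_vec_diff
       real_vec_ann real_vec_cre)

lemma qp_annih_eq: "qp_annih \<Lambda> lab \<theta> k \<sigma> = (\<lambda>v. rot \<theta> (ann (lab k, \<sigma>) (rot (\<lambda>k. - \<theta> k) v)))"
  by (rule ext) (simp only: qp_annih_def i_G_B_eq_gen neg_i_G_B_eq_gen annih_eq_ann)

lemma real_vec_qp_creat: "real_vec v \<Longrightarrow> real_vec (qp_creat \<Lambda> lab \<theta> k \<sigma> v)"
  unfolding qp_creat_def qp_annih_eq
  by (rule real_vec_op_adjoint)
     (auto intro!: clinearI real_vec_rot real_vec_ann
       simp: vec.linear_add[OF clinear_rot] vec.linear_scale[OF clinear_rot] mode_linear_simps)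

lemma real_vec_Psi: "real_vec (Psi \<Lambda> lab \<xi> U \<Delta> \<theta>)"
  unfolding Psi_def Phi_def Psi_BCS_eq_rot
  by (intro real_vec_scaleR real_vec_add real_vec_sum real_vec_qp_creat real_vec_rot real_vec_axis)

lemma pair_expectation_real: "pair_expectation lab (Psi \<Lambda> lab \<xi> U \<Delta> \<theta>) k \<in> \<real>"
  unfolding pair_expectation_def annih_eq_ann
  by (intro cinner_real_vec real_vec_ann real_vec_Psi)

subsection \<open>Diagonalization of the mean field Hamiltonian\<close>

definition shift :: "(real ^ 3 \<Rightarrow> real) \<Rightarrow> (real ^ 3 \<Rightarrow> real ^ 3 \<Rightarrow> real) \<Rightarrow> (real ^ 3 \<Rightarrow> real)
    \<Rightarrow> (real ^ 3 \<Rightarrow> real) \<Rightarrow> real" where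
  "shift \<xi> U \<Delta> \<theta> = (\<Sum>k\<in>\<Lambda>. \<Delta> k * Re (pair_expectation lab (Psi \<Lambda> lab \<xi> U \<Delta> \<theta>) k))"

lemma of_real_shift:
  "complex_of_real (shift \<xi> U \<Delta> \<theta>)
    = (\<Sum>k\<in>\<Lambda>. complex_of_real (\<Delta> k) * pair_expectation lab (Psi \<Lambda> lab \<xi> U \<Delta> \<theta>) k)"
  unfolding shift_def using pair_expectation_real by (simp add: of_real_Re)

text \<open>Reflecting the momentum in the spin-down kinetic sum groups \<open>k\<close> up with
  \<open>-k\<close> down. The term \<open>sum \<xi> \<Lambda>\<close> compensates for the -1
  contained in each \<open>pair_num\<close>.\<close>

lemma H_M_eq:
  assumes even: "\<And>k. k \<in> \<Lambda> \<Longrightarrow> \<xi> (- k) = \<xi> k"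
  shows "H_M \<Lambda> lab \<xi> U \<Delta> \<theta> v =
    (\<Sum>k\<in>\<Lambda>. \<xi> k *\<^sub>R pair_num (up k) (down_neg k) v - \<Delta> k *\<^sub>R pair_sym (up k) (down_neg k) v)
    + (sum \<xi> \<Lambda> + shift \<xi> U \<Delta> \<theta>) *\<^sub>R v"
proof -
  have "(\<Sum>k\<in>\<Lambda>. \<xi> k *\<^sub>R cre (lab k, Down) (ann (lab k, Down) v))
      = (\<Sum>k\<in>\<Lambda>. \<xi> k *\<^sub>R cre (down_neg k) (ann (down_neg k) v))"
    by (subst sum_neg[symmetric]) (auto intro!: sum.cong simp: even)
  then show ?thesis
    unfolding H_M_def annih_eq_ann creat_eq_cre
    by (simp add: pair_num_def pair_sym_def scaleR_add_right scaleR_diff_right scaleR_add_left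
        scaleR_left.sum sum.distrib sum_subtractf scaleR_eq_smult[of "shift \<xi> U \<Delta> \<theta>"] of_real_shift)
qed

lemma clinear_H_M: "clinear (H_M \<Lambda> lab \<xi> U \<Delta> \<theta>)"
  unfolding H_M_def annih_eq_ann creat_eq_cre
  by (rule clinearI)
     (simp_all add: mode_linear_simps scaleR_eq_smult vec.scale_right_distrib
       vec.scale_right_diff_distrib sum.distrib vec.scale_sum_right mult.commute algebra_simps)

text \<open>Number terms are their own adjoints, annihilating and creating pair terms are exchanged,
  and the constant is real by \<open>of_real_shift\<close>.\<close>

lemma selfadjoint_H_M: "selfadjoint (H_M \<Lambda> lab \<xi> U \<Delta> \<theta>)"
  unfolding selfadjoint_def H_M_def annih_eq_ann creat_eq_cre
  by (simp add: scaleR_eq_smult cinner_simps cinner_ann cinner_cre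
      algebra_simps flip: of_real_shift)

definition level :: "(real ^ 3 \<Rightarrow> real) \<Rightarrow> (real ^ 3 \<Rightarrow> real ^ 3 \<Rightarrow> real) \<Rightarrow> (real ^ 3 \<Rightarrow> real)
    \<Rightarrow> (real ^ 3 \<Rightarrow> real) \<Rightarrow> 'q occ \<Rightarrow> real" where
  "level \<xi> U \<Delta> \<theta> n =
     (\<Sum>k\<in>\<Lambda>. qp_energy \<xi> \<Delta> k * (of_bool (n (lab k, Up)) + of_bool (n (lab k, Down))))
     + (\<Sum>k\<in>\<Lambda>. \<xi> k - qp_energy \<xi> \<Delta> k) + shift \<xi> U \<Delta> \<theta>"

text \<open>For each \<open>k\<close> the hypotheses turn the pair term into
  \<open>qp_energy\<close> times the rotated \<open>pair_num\<close>. By \<open>rot_pair_num\<close>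
  this acts on a rotated basis vector as \<open>pair_num\<close> acts on the basis vector itself,
  with eigenvalue the occupation of the pair minus 1.\<close>

lemma H_M_rot_axis:
  assumes \<xi>_even: "\<And>k. k \<in> \<Lambda> \<Longrightarrow> \<xi> (- k) = \<xi> k" and \<Delta>_even: "\<And>k. k \<in> \<Lambda> \<Longrightarrow> \<Delta> (- k) = \<Delta> k"
    and cos: "\<And>k. k \<in> \<Lambda> \<Longrightarrow> \<xi> k = qp_energy \<xi> \<Delta> k * cos (2 * \<theta> k)"
    and sin: "\<And>k. k \<in> \<Lambda> \<Longrightarrow> \<Delta> k = qp_energy \<xi> \<Delta> k * sin (2 * \<theta> k)"
  shows "H_M \<Lambda> lab \<xi> U \<Delta> \<theta> (rot \<theta> (axis n 1))
    = complex_of_real (level \<xi> U \<Delta> \<theta> n) *s rot \<theta> (axis n 1)"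
proof -
  let ?E = "qp_energy \<xi> \<Delta>" and ?\<psi> = "rot \<theta> (axis n 1)"
  have mode: "\<xi> k *\<^sub>R pair_num (up k) (down_neg k) ?\<psi> - \<Delta> k *\<^sub>R pair_sym (up k) (down_neg k) ?\<psi>
      = (?E k * (of_bool (n (up k)) + of_bool (n (down_neg k)) - 1)) *\<^sub>R ?\<psi>" if "k \<in> \<Lambda>" for k
  proof -
    have "\<xi> k *\<^sub>R pair_num (up k) (down_neg k) ?\<psi> - \<Delta> k *\<^sub>R pair_sym (up k) (down_neg k) ?\<psi>
        = ?E k *\<^sub>R (cos (2 * \<theta> k) *\<^sub>R pair_num (up k) (down_neg k) ?\<psi>
          - sin (2 * \<theta> k) *\<^sub>R pair_sym (up k) (down_neg k) ?\<psi>)"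
      using cos[OF that] sin[OF that] by (simp add: scaleR_diff_right)
    also have "\<dots> = ?E k *\<^sub>R rot \<theta> (pair_num (up k) (down_neg k) (axis n 1))"
      by (simp add: rot_pair_num[OF that])
    also have "pair_num (up k) (down_neg k) (axis n 1)
        = (of_bool (n (up k)) + of_bool (n (down_neg k)) - 1 :: real) *\<^sub>R axis n 1"
      by (simp add: pair_num_def number_axis)
    finally show ?thesis
      by (simp add: linear_scale[OF clinear_imp_linear[OF clinear_rot]])
  qed
  \<comment> \<open>Evenness of the quasiparticle energy undoes the reflection of the spin-down
    momenta.\<close>
  have "(\<Sum>k\<in>\<Lambda>. ?E k * of_bool (n (down_neg k))) = (\<Sum>k\<in>\<Lambda>. ?E k * of_bool (n (lab k, Down)))"
    by (subst sum_neg[symmetric]) (auto intro!: sum.cong simp: qp_energy_def \<xi>_even \<Delta>_even)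
  then have "(\<Sum>k\<in>\<Lambda>. ?E k * (of_bool (n (up k)) + of_bool (n (down_neg k)) - 1))
      + (sum \<xi> \<Lambda> + shift \<xi> U \<Delta> \<theta>) = level \<xi> U \<Delta> \<theta> n"
    by (simp add: level_def algebra_simps sum.distrib sum_subtractf)
  then show ?thesis
    by (subst H_M_eq)
       (simp_all add: \<xi>_even mode scaleR_eq_smult[symmetric] scaleR_left.sum[symmetric] scaleR_add_left[symmetric])
qed

section \<open>Energy levels relative to the vacuum level\<close>

lemma level_vacuum:
  "complex_of_real (level \<xi> U \<Delta> \<theta> (\<lambda>_. False))
    = (\<Sum>k\<in>\<Lambda>. complex_of_real (\<xi> k - qp_energy \<xi> \<Delta> k)
        + complex_of_real (\<Delta> k) * pair_expectation lab (Psi \<Lambda> lab \<xi> U \<Delta> \<theta>) k)"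
  by (simp add: level_def of_real_shift sum.distrib)

lemma level_eq_vacuum:
  "level \<xi> U \<Delta> \<theta> n =
    (\<Sum>k\<in>\<Lambda>. qp_energy \<xi> \<Delta> k * (of_bool (n (lab k, Up)) + of_bool (n (lab k, Down))))
    + level \<xi> U \<Delta> \<theta> (\<lambda>_. False)"
  by (simp add: level_def)

lemma level_vacuum_less:
  assumes pos: "\<And>k. k \<in> \<Lambda> \<Longrightarrow> qp_energy \<xi> \<Delta> k > 0" and "n \<noteq> (\<lambda>_. False)"
  shows "level \<xi> U \<Delta> \<theta> (\<lambda>_. False) < level \<xi> U \<Delta> \<theta> n"
proof -
  obtain q \<sigma> where "n (q, \<sigma>)"
    using assms(2) by (auto simp: fun_eq_iff)
  moreover have "q \<in> lab ` \<Lambda>"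
    using bij_lab by (simp add: bij_betw_def)
  then obtain k where k: "k \<in> \<Lambda>" "lab k = q"
    by blast
  ultimately have "n (lab k, Up) \<or> n (lab k, Down)"
    by (cases \<sigma>) auto
  then have "0 < (\<Sum>k\<in>\<Lambda>. qp_energy \<xi> \<Delta> k * (of_bool (n (lab k, Up)) + of_bool (n (lab k, Down))))"
    using pos[OF k(1)] by (intro sum_pos2[OF finite_momenta k(1)]) (auto simp: less_imp_le[OF pos])
  then show ?thesis
    by (simp add: level_eq_vacuum[of \<xi> U \<Delta> \<theta> n])
qed

lemma range_level:
  "(\<exists>n. z = complex_of_real (level \<xi> U \<Delta> \<theta> n)) \<longleftrightarrow>
   (\<exists>N :: real ^ 3 \<Rightarrow> spin \<Rightarrow> nat.
      z = complex_of_real ((\<Sum>k\<in>\<Lambda>. qp_energy \<xi> \<Delta> k * (real (N k Up) + real (N k Down)))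
            + level \<xi> U \<Delta> \<theta> (\<lambda>_. False))
      \<and> (\<forall>k\<in>\<Lambda>. \<forall>\<sigma>. N k \<sigma> \<in> {0, 1}))" (is "?L \<longleftrightarrow> ?R")
proof
  assume ?L
  then obtain n where "z = complex_of_real (level \<xi> U \<Delta> \<theta> n)" ..
  then show ?R
    unfolding level_eq_vacuum[of \<xi> U \<Delta> \<theta> n]
    by (intro exI[of _ "\<lambda>k \<sigma>. of_bool (n (lab k, \<sigma>))"]) auto
next
  assume ?R
  then obtain N :: "real ^ 3 \<Rightarrow> spin \<Rightarrow> nat" where
    z: "z = complex_of_real ((\<Sum>k\<in>\<Lambda>. qp_energy \<xi> \<Delta> k * (real (N k Up) + real (N k Down)))
            + level \<xi> U \<Delta> \<theta> (\<lambda>_. False))"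
    and N: "\<And>k \<sigma>. k \<in> \<Lambda> \<Longrightarrow> N k \<sigma> \<in> {0, 1}"
    by blast
  \<comment> \<open>\<open>inv_into\<close> recovers the momentum from its index, so
    \<open>n\<close> agrees with \<open>N\<close> on \<open>\<Lambda>\<close>, where
    \<open>N\<close> takes only the values 0 and 1.\<close>
  define n where "n = (\<lambda>(q, \<sigma>). N (inv_into \<Lambda> lab q) \<sigma> = 1)"
  have "real (N k \<sigma>) = of_bool (n (lab k, \<sigma>))" if "k \<in> \<Lambda>" for k \<sigma>
    using N[OF that, of \<sigma>] bij_lab that by (auto simp: n_def bij_betw_def)
  then have "z = complex_of_real (level \<xi> U \<Delta> \<theta> n)"
    unfolding z level_eq_vacuum[of \<xi> U \<Delta> \<theta> n] by simp
  then show ?L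
    by blast
qed

end

section \<open>The concrete momentum set and the conclusion\<close>

lemma momenta_neg: "k \<in> momenta L Kmax \<Longrightarrow> - k \<in> momenta L Kmax"
proof -
  assume "k \<in> momenta L Kmax"
  then obtain n1 n2 n3 :: int where
    k: "k = (2 * pi / L) *\<^sub>R vector [real_of_int n1, real_of_int n2, real_of_int n3]"
    and le: "2 * pi / L * sqrt (real_of_int (n1\<^sup>2 + n2\<^sup>2 + n3\<^sup>2)) \<le> Kmax"
    unfolding momenta_def by blast
  have "- k = (2 * pi / L) *\<^sub>R vector [real_of_int (- n1), real_of_int (- n2), real_of_int (- n3)]"
    unfolding k by (simp add: vec_eq_iff forall_3)
  moreover have "2 * pi / L * sqrt (real_of_int ((- n1)\<^sup>2 + (- n2)\<^sup>2 + (- n3)\<^sup>2)) \<le> Kmax"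
    using le by simp
  ultimately show ?thesis
    unfolding momenta_def by blast
qed

text \<open>Speaking of "the" ground state includes uniqueness, which for unit vectors means
  uniqueness up to a phase; this is the second conjunct. The energy formula is an equation between
  complex numbers, so it also asserts that the sum of expectations is real.\<close>

theorem corollary6p9:
  fixes L Kmax m \<mu> hbar :: real
    and \<Lambda> :: "(real ^ 3) set"
    and lab :: "real ^ 3 \<Rightarrow> 'q::{finite,linorder}"
    and \<xi> \<Delta> \<theta> :: "real ^ 3 \<Rightarrow> real"
    and U :: "real ^ 3 \<Rightarrow> real ^ 3 \<Rightarrow> real"
  assumes "L > 0" and "Kmax > 0"
    and "\<Lambda> = momenta L Kmax"
    and "bij_betw lab \<Lambda> UNIV"
    and "m > 0" and "\<mu> > 0" and "hbar > 0"
    and "\<xi> = dispersion hbar m \<mu>"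
    and "\<forall>k\<in>\<Lambda>. \<forall>k'\<in>\<Lambda>. U k k' \<le> 0"
    and "\<forall>k\<in>\<Lambda>. \<forall>k'\<in>\<Lambda>. U k' k = U k k'"
    and "\<forall>k\<in>\<Lambda>. \<forall>k'\<in>\<Lambda>. U (- k) (- k') = U k k'"
    and "\<forall>k\<in>\<Lambda>. U k k = 0"
    and "\<forall>k\<in>\<Lambda>. \<Delta> k \<ge> 0"
    and "\<forall>k\<in>\<Lambda>. \<Delta> (- k) = \<Delta> k"
    and "\<forall>k\<in>\<Lambda>. qp_energy \<xi> \<Delta> k > 0"
    and "solves_gap_equation \<Lambda> \<xi> U \<Delta>"
    and "\<forall>k\<in>\<Lambda>. 0 \<le> \<theta> k \<and> \<theta> k \<le> pi / 2"
    and "\<forall>k\<in>\<Lambda>. sin (2 * \<theta> k) = \<Delta> k / qp_energy \<xi> \<Delta> k"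
    and "\<forall>k\<in>\<Lambda>. cos (2 * \<theta> k) = \<xi> k / qp_energy \<xi> \<Delta> k"
  shows "is_ground_state (H_M \<Lambda> lab \<xi> U \<Delta> \<theta>) (Psi_BCS \<Lambda> lab \<theta>)
    \<and> (\<forall>\<phi>. is_ground_state (H_M \<Lambda> lab \<xi> U \<Delta> \<theta>) \<phi> \<longrightarrow>
           (\<exists>c. cmod c = 1 \<and> \<phi> = c *s Psi_BCS \<Lambda> lab \<theta>))
    \<and> complex_of_real (ground_state_energy (H_M \<Lambda> lab \<xi> U \<Delta> \<theta>)) =
           (\<Sum>k\<in>\<Lambda>. complex_of_real (\<xi> k - sqrt ((\<xi> k)\<^sup>2 + (\<Delta> k)\<^sup>2)) +
              complex_of_real (\<Delta> k) * pair_expectation lab (Psi \<Lambda> lab \<xi> U \<Delta> \<theta>) k)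
    \<and> op_spectrum (H_M \<Lambda> lab \<xi> U \<Delta> \<theta>) =
           {complex_of_real ((\<Sum>k\<in>\<Lambda>. sqrt ((\<xi> k)\<^sup>2 + (\<Delta> k)\<^sup>2) * (real (N k Up) + real (N k Down)))
              + ground_state_energy (H_M \<Lambda> lab \<xi> U \<Delta> \<theta>)) | N :: real ^ 3 \<Rightarrow> spin \<Rightarrow> nat.
            \<forall>k\<in>\<Lambda>. \<forall>\<sigma>. N k \<sigma> \<in> {0, 1}}"
proof -
  interpret momentum_lattice \<Lambda> lab
    using assms(3,4) momenta_neg by unfold_locales auto
  note E_pos = assms(15)[rule_format]
  have \<xi>_even: "\<xi> (- k) = \<xi> k" for k
    by (simp add: assms(8) dispersion_def)
  have diag: "H_M \<Lambda> lab \<xi> U \<Delta> \<theta> (rot \<theta> (axis n 1))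
      = complex_of_real (level \<xi> U \<Delta> \<theta> n) *s rot \<theta> (axis n 1)" for n
    \<comment> \<open>Positivity of the quasiparticle energies clears the denominators in the
      equations for \<open>cos (2 * \<theta> k)\<close> and
      \<open>sin (2 * \<theta> k)\<close>.\<close>
    using assms(14,18,19) by (intro H_M_rot_axis) (auto simp: \<xi>_even less_imp_neq[OF E_pos, symmetric])
  have less: "level \<xi> U \<Delta> \<theta> (\<lambda>_. False) < level \<xi> U \<Delta> \<theta> n" if "n \<noteq> (\<lambda>_. False)" for n
    using level_vacuum_less[OF E_pos that] .
  then have min: "level \<xi> U \<Delta> \<theta> (\<lambda>_. False) \<le> level \<xi> U \<Delta> \<theta> n" for n
    by (cases "n = (\<lambda>_. False)") (auto intro: less_imp_le)
  note V = clinear_rot norm_rot clinear_H_M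
  have energy: "ground_state_energy (H_M \<Lambda> lab \<xi> U \<Delta> \<theta>) = level \<xi> U \<Delta> \<theta> (\<lambda>_. False)"
    by (rule diagonalized_ground_state_energy[where \<epsilon> = "level \<xi> U \<Delta> \<theta>", OF V diag min])
  have ground: "is_ground_state (H_M \<Lambda> lab \<xi> U \<Delta> \<theta>) (Psi_BCS \<Lambda> lab \<theta>)"
    unfolding Psi_BCS_eq_rot
    by (rule diagonalized_ground_state[where \<epsilon> = "level \<xi> U \<Delta> \<theta>", OF V selfadjoint_H_M diag min])
  have unique: "\<exists>c. cmod c = 1 \<and> \<phi> = c *s Psi_BCS \<Lambda> lab \<theta>"
    if "is_ground_state (H_M \<Lambda> lab \<xi> U \<Delta> \<theta>) \<phi>" for \<phi>
    unfolding Psi_BCS_eq_rot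
    by (rule diagonalized_ground_state_unique[where \<epsilon> = "level \<xi> U \<Delta> \<theta>", OF V diag less that])
  have spectrum: "op_spectrum (H_M \<Lambda> lab \<xi> U \<Delta> \<theta>)
      = {z. \<exists>n. z = complex_of_real (level \<xi> U \<Delta> \<theta> n)}"
    unfolding op_spectrum_eq_eigenvalues[OF clinear_H_M] diagonalized_eigenvalue_iff[OF V diag] ..
  show ?thesis
    unfolding qp_energy_def[symmetric] energy spectrum range_level
    using ground unique level_vacuum by blast
qed

end
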